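(* Let $\alpha_1,\lambda\in\mathbb{C}$ and $t_1,t_2\in\mathbb{C}\setminus\{0\}$. (i) Let $h_1,h_2\in\mathbb{C}$. Consider the equation of type $(0,2)$: $$\text{(A)}\quad g(qx)+q^{2\lambda+1}(1-q^{-h_1-1/2}t_1^{-1}x)(1-q^{-h_2-1/2}t_2^{-1}x)g(x/q)$$ $$-\big[q^{\alpha_1+2\lambda-h_1-h_2}t_1^{-1}t_2^{-1}x^2-q^{\lambda+1/2}(q^{-h_1}t_1^{-1}+q^{-h_2}t_2^{-1})x+q^\lambda(q+1)\big]g(x)=0,$$ and the equation $$\text{(B)}\quad q^{2\lambda+1}g(x/q)+(1-q^{-l_1+1/2}t_1^{-1}x)(1-q^{-l_2+1/2}t_2^{-1}x)g(qx)$$ $$-\big[q^{-\tilde\alpha_1-l_1-l_2+1}t_1^{-1}t_2^{-1}x^2-q^{\lambda+1/2}(q^{-l_2}t_2^{-1}+q^{-l_1}t_1^{-1})x+q^\lambda(q+1)\big]g(x)=0,$$ where $l_1=h_1$, $l_2=h_2$, $\tilde\alpha_1+\alpha_1=1-2\lambda$. If a function $y(x)$ satisfies (A), then $u(x)=(q^{-h_1+1/2}t_1^{-1}x;q)_\infty(q^{-h_2+1/2}t_2^{-1}x;q)_\infty\,y(x)$ is a solution of (B). Conversely, if a function $u(x)$ satisfies (B), then $y(x)=u(x)/\big((q^{-l_1+1/2}t_1^{-1}x;q)_\infty(q^{-l_2+1/2}t_2^{-1}x;q)_\infty\big)$ satisfies (A), with the same relationship among the parameters. (ii) Let $h_1,h_2\in\mathbb{C}$.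 The functions $$g_1(x)=x^{-\alpha_1}\sum_{n=0}^\infty(q^{-\lambda-\alpha_1+1/2}x^{-1})^n(q^{\lambda+\alpha_1};q)_n\sum_{\ell=0}^n\frac{q^{-\ell(n-\ell)}(q^{h_1}t_1)^{n-\ell}(q^{h_2}t_2)^\ell}{(q;q)_{n-\ell}(q;q)_\ell},$$ $$g_2(x)=\big((q^{-h_1+1/2}t_1^{-1}x;q)_\infty(q^{-h_2+1/2}t_2^{-1}x;q)_\infty\big)^{-1}x^{2\lambda+\alpha_1-1}\sum_{n=0}^\infty(q^{1/2}x^{-1})^n(q^{-\lambda-\alpha_1+1};q)_n\sum_{k=0}^n\frac{(q^{h_1}t_1)^k(q^{h_2}t_2)^{n-k}}{(q;q)_k(q;q)_{n-k}}$$ are formal solutions of equation (A) displayed in (i). (iii) Let $l_1,l_2\in\mathbb{C}$. The functions $$g_3(x)=(q^{-l_1+1/2}t_1^{-1}x;q)_\infty(q^{-l_2+1/2}t_2^{-1}x;q)_\infty\,x^{2\lambda+\alpha_1-1}\sum_{n=0}^\infty(q^{\lambda+\alpha_1-1/2}x^{-1})^n(q^{-\lambda-\alpha_1+1};q)_n\sum_{\ell=0}^n\frac{q^{-\ell(n-\ell)}(q^{l_1}t_1)^{n-\ell}(q^{l_2}t_2)^\ell}{(q;q)_{n-\ell}(q;q)_\ell},$$ $$g_4(x)=x^{-\alpha_1}\sum_{n=0}^\infty(q^{1/2}x^{-1})^n(q^{\lambda+\alpha_1};q)_n\sum_{k=0}^n\frac{(q^{l_1}t_1)^k(q^{l_2}t_2)^{n-k}}{(q;q)_k(q;q)_{n-k}}$$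 are formal solutions of the equation of type $(2,0)$ $$q^{-2\lambda-1}(1-q^{-l_1+1/2}t_1^{-1}x)(1-q^{-l_2+1/2}t_2^{-1}x)g(qx)+g(x/q)$$ $$-\big[q^{-\alpha_1-l_1-l_2-2\lambda}t_1^{-1}t_2^{-1}x^2-q^{-\lambda-1/2}(q^{-l_1}t_1^{-1}+q^{-l_2}t_2^{-1})x+q^{-\lambda}(1+q^{-1})\big]g(x)=0.$$
   Context: Conventions: $q\in\mathbb{C}$, $0<|q|<1$, with a fixed choice of $\log q$, and $q^a=\exp(a\log q)$. $(\lambda;q)_n=\prod_{j=0}^{n-1}(1-\lambda q^j)$, $(z;q)_\infty=\prod_{i=0}^\infty(1-q^iz)$. In (i), functions are complex-valued functions of $x$ on a set stable under multiplication by $q^{\pm1}$, a function satisfies an equation if the identity holds with $g$ replaced by it, and in the converse direction the identity is understood where the infinite products occurring in denominators do not vanish (or as an identity of meromorphic functions). Formal solutions: convergence of the series is not considered. For $\mu\in\mathbb{C}$, $x^\mu$ is a symbol with $(q^{\pm1}x)^\mu=q^{\pm\mu}x^\mu$. An expression $P(x)\,x^\mu\sum_{n\ge0}a_nx^{-n}$, where $P(x)$ is $1$ or a product of factors $(\beta x;q)_\infty^{\pm1}$, is a formal solution of a $q$-difference equation if, after termwise substitution and use of $(\beta qx;q)_\infty=(\beta x;q)_\infty/(1-\beta x)$ and $(\beta x/q;q)_\infty=(1-\beta x/q)(\beta x;q)_\infty$ to factor out $P(x)$ (the rational factors produced combining with the polynomial coefficients of the equation), the coefficient of every power of $x$ in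 the remaining formal series $x^{\mu+2}\sum_{m\ge0}b_mx^{-m}$ is zero. *)

theory Defs
  imports "HOL-Analysis.Analysis" "HOL-Computational_Algebra.Computational_Algebra"
begin

text \<open>
  Throughout, \<open>q\<close> is the base and \<open>L\<close> the chosen value of \<open>log q\<close>, so that \<open>exp L = q\<close>.
\<close>

definition qpow :: "complex \<Rightarrow> complex \<Rightarrow> complex" where
  "qpow L a = exp (a * L)"

definition qpoch :: "complex \<Rightarrow> complex \<Rightarrow> nat \<Rightarrow> complex" where
  "qpoch q z n = (\<Prod>j<n. 1 - z * q ^ j)"

definition qpoch_inf :: "complex \<Rightarrow> complex \<Rightarrow> complex" where
  "qpoch_inf q z = (\<Prod>i. 1 - q ^ i * z)"

text \<open>
  The record with fields \<open>a\<close>, \<open>b\<close>, \<open>c\<close> stands for the second order equation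
  \<open>a(x) g(qx) + b(x) g(x/q) - c(x) g(x) = 0\<close> (note the sign of the last term).
\<close>

record qde =
  up_coeff :: "complex poly"
  down_coeff :: "complex poly"
  mid_coeff :: "complex poly"

definition holds_at :: "complex \<Rightarrow> qde \<Rightarrow> (complex \<Rightarrow> complex) \<Rightarrow> complex \<Rightarrow> bool" where
  "holds_at q E g x \<longleftrightarrow>
     poly (up_coeff E) x * g (q * x) + poly (down_coeff E) x * g (x / q)
       - poly (mid_coeff E) x * g x = 0"

definition q_stable :: "complex \<Rightarrow> complex set \<Rightarrow> bool" where
  "q_stable q D \<longleftrightarrow> (\<forall>x\<in>D. q * x \<in> D \<and> x / q \<in> D)"

definition eqn_A ::
  "complex \<Rightarrow> complex \<Rightarrow> complex \<Rightarrow> complex \<Rightarrow> complex \<Rightarrow> complex \<Rightarrow> complex \<Rightarrow> complex \<Rightarrow> qde" where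
  "eqn_A q L \<alpha> lam h1 h2 t1 t2 =
     \<lparr> up_coeff = 1,
       down_coeff = smult (qpow L (2 * lam + 1))
         ([:1, - (qpow L (- h1 - 1/2) / t1):] * [:1, - (qpow L (- h2 - 1/2) / t2):]),
       mid_coeff =
         [: qpow L lam * (q + 1),
            - (qpow L (lam + 1/2) * (qpow L (- h1) / t1 + qpow L (- h2) / t2)),
            qpow L (\<alpha> + 2 * lam - h1 - h2) / (t1 * t2) :] \<rparr>"

definition eqn_B ::
  "complex \<Rightarrow> complex \<Rightarrow> complex \<Rightarrow> complex \<Rightarrow> complex \<Rightarrow> complex \<Rightarrow> complex \<Rightarrow> complex \<Rightarrow> qde" where
  "eqn_B q L \<alpha>' lam l1 l2 t1 t2 =
     \<lparr> up_coeff =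
         [:1, - (qpow L (- l1 + 1/2) / t1):] * [:1, - (qpow L (- l2 + 1/2) / t2):],
       down_coeff = [: qpow L (2 * lam + 1) :],
       mid_coeff =
         [: qpow L lam * (q + 1),
            - (qpow L (lam + 1/2) * (qpow L (- l2) / t2 + qpow L (- l1) / t1)),
            qpow L (- \<alpha>' - l1 - l2 + 1) / (t1 * t2) :] \<rparr>"

definition eqn_20 ::
  "complex \<Rightarrow> complex \<Rightarrow> complex \<Rightarrow> complex \<Rightarrow> complex \<Rightarrow> complex \<Rightarrow> complex \<Rightarrow> complex \<Rightarrow> qde" where
  "eqn_20 q L \<alpha> lam l1 l2 t1 t2 =
     \<lparr> up_coeff = smult (qpow L (- 2 * lam - 1))
         ([:1, - (qpow L (- l1 + 1/2) / t1):] * [:1, - (qpow L (- l2 + 1/2) / t2):]),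
       down_coeff = 1,
       mid_coeff =
         [: qpow L (- lam) * (1 + 1 / q),
            - (qpow L (- lam - 1/2) * (qpow L (- l1) / t1 + qpow L (- l2) / t2)),
            qpow L (- \<alpha> - l1 - l2 - 2 * lam) / (t1 * t2) :] \<rparr>"

text \<open>
  A formal expression \<open>P(x) x\<^sup>\<mu> (a\<^sub>0 + a\<^sub>1 x\<^sup>-\<^sup>1 + a\<^sub>2 x\<^sup>-\<^sup>2 + \<dots>)\<close>.  A pair \<open>(\<beta>, e)\<close> in
  \<open>factors\<close> stands for the factor \<open>(\<beta>x;q)\<^sub>\<infinity>\<^sup>e\<close> of \<open>P\<close>.
\<close>

record qformal =
  factors :: "(complex \<times> int) list"
  expo :: complex
  coeffs :: "nat \<Rightarrow> complex"

text \<open>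
  Below, formal Laurent series are series in the variable \<open>x\<^sup>-\<^sup>1\<close>, so \<open>x\<close> itself is \<^const>\<open>fls_X_inv\<close>.
  They form a field containing the rational functions of \<open>x\<close>; in that field the rational factors
  \<open>P(qx)/P(x)\<close> and \<open>P(x/q)/P(x)\<close> are multiplied with the coefficients of the equation.
  The common factor \<open>P(x) x\<^sup>\<mu>\<close> is dropped from all terms.
\<close>

definition poly_fls :: "complex poly \<Rightarrow> complex fls" where
  "poly_fls p = poly (map_poly fls_const p) fls_X_inv"

definition lin_factor :: "complex \<Rightarrow> complex fls" where
  "lin_factor \<beta> = 1 - fls_const \<beta> * fls_X_inv"

definition shift_none :: "qformal \<Rightarrow> complex fls" where
  "shift_none g = fps_to_fls (Abs_fps (coeffs g))"

text \<open>\<open>g(qx) / (P(x) x\<^sup>\<mu>)\<close>, using \<open>(\<beta>qx;q)\<^sub>\<infinity> = (\<beta>x;q)\<^sub>\<infinity> / (1 - \<beta>x)\<close>:\<close>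

definition shift_up :: "complex \<Rightarrow> complex \<Rightarrow> qformal \<Rightarrow> complex fls" where
  "shift_up q L g =
     prod_list (map (\<lambda>(\<beta>, e). lin_factor \<beta> powi (- e)) (factors g))
       * fls_const (qpow L (expo g)) * fps_to_fls (Abs_fps (\<lambda>n. coeffs g n / q ^ n))"

text \<open>\<open>g(x/q) / (P(x) x\<^sup>\<mu>)\<close>, using \<open>(\<beta>x/q;q)\<^sub>\<infinity> = (1 - \<beta>x/q) (\<beta>x;q)\<^sub>\<infinity>\<close>:\<close>

definition shift_down :: "complex \<Rightarrow> complex \<Rightarrow> qformal \<Rightarrow> complex fls" where
  "shift_down q L g =
     prod_list (map (\<lambda>(\<beta>, e). lin_factor (\<beta> / q) powi e) (factors g))
       * fls_const (qpow L (- expo g)) * fps_to_fls (Abs_fps (\<lambda>n. coeffs g n * q ^ n))"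

definition formal_solution :: "complex \<Rightarrow> complex \<Rightarrow> qde \<Rightarrow> qformal \<Rightarrow> bool" where
  "formal_solution q L E g \<longleftrightarrow>
     poly_fls (up_coeff E) * shift_up q L g + poly_fls (down_coeff E) * shift_down q L g
       - poly_fls (mid_coeff E) * shift_none g = 0"

definition inner_sum_twisted ::
  "complex \<Rightarrow> complex \<Rightarrow> complex \<Rightarrow> complex \<Rightarrow> nat \<Rightarrow> complex" where
  "inner_sum_twisted q L s1 s2 n =
     (\<Sum>l\<le>n. qpow L (- (of_nat l * of_nat (n - l))) * s1 ^ (n - l) * s2 ^ l
        / (qpoch q q (n - l) * qpoch q q l))"

definition inner_sum ::
  "complex \<Rightarrow> complex \<Rightarrow> complex \<Rightarrow> nat \<Rightarrow> complex" where
  "inner_sum q s1 s2 n =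
     (\<Sum>k\<le>n. s1 ^ k * s2 ^ (n - k) / (qpoch q q k * qpoch q q (n - k)))"

definition g1 ::
  "complex \<Rightarrow> complex \<Rightarrow> complex \<Rightarrow> complex \<Rightarrow> complex \<Rightarrow> complex \<Rightarrow> complex \<Rightarrow> complex \<Rightarrow> qformal" where
  "g1 q L \<alpha> lam h1 h2 t1 t2 =
     \<lparr> factors = [],
       expo = - \<alpha>,
       coeffs = (\<lambda>n. qpow L (- lam - \<alpha> + 1/2) ^ n * qpoch q (qpow L (lam + \<alpha>)) n
         * inner_sum_twisted q L (qpow L h1 * t1) (qpow L h2 * t2) n) \<rparr>"

definition g2 ::
  "complex \<Rightarrow> complex \<Rightarrow> complex \<Rightarrow> complex \<Rightarrow> complex \<Rightarrow> complex \<Rightarrow> complex \<Rightarrow> complex \<Rightarrow> qformal" where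
  "g2 q L \<alpha> lam h1 h2 t1 t2 =
     \<lparr> factors = [(qpow L (- h1 + 1/2) / t1, - 1), (qpow L (- h2 + 1/2) / t2, - 1)],
       expo = 2 * lam + \<alpha> - 1,
       coeffs = (\<lambda>n. qpow L (1/2) ^ n * qpoch q (qpow L (- lam - \<alpha> + 1)) n
         * inner_sum q (qpow L h1 * t1) (qpow L h2 * t2) n) \<rparr>"

definition g3 ::
  "complex \<Rightarrow> complex \<Rightarrow> complex \<Rightarrow> complex \<Rightarrow> complex \<Rightarrow> complex \<Rightarrow> complex \<Rightarrow> complex \<Rightarrow> qformal" where
  "g3 q L \<alpha> lam l1 l2 t1 t2 =
     \<lparr> factors = [(qpow L (- l1 + 1/2) / t1, 1), (qpow L (- l2 + 1/2) / t2, 1)],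
       expo = 2 * lam + \<alpha> - 1,
       coeffs = (\<lambda>n. qpow L (lam + \<alpha> - 1/2) ^ n * qpoch q (qpow L (- lam - \<alpha> + 1)) n
         * inner_sum_twisted q L (qpow L l1 * t1) (qpow L l2 * t2) n) \<rparr>"

definition g4 ::
  "complex \<Rightarrow> complex \<Rightarrow> complex \<Rightarrow> complex \<Rightarrow> complex \<Rightarrow> complex \<Rightarrow> complex \<Rightarrow> complex \<Rightarrow> qformal" where
  "g4 q L \<alpha> lam l1 l2 t1 t2 =
     \<lparr> factors = [],
       expo = - \<alpha>,
       coeffs = (\<lambda>n. qpow L (1/2) ^ n * qpoch q (qpow L (lam + \<alpha>)) n
         * inner_sum q (qpow L l1 * t1) (qpow L l2 * t2) n) \<rparr>"

definition prefactor ::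
  "complex \<Rightarrow> complex \<Rightarrow> complex \<Rightarrow> complex \<Rightarrow> complex \<Rightarrow> complex \<Rightarrow> complex \<Rightarrow> complex" where
  "prefactor q L h1 h2 t1 t2 x =
     qpoch_inf q (qpow L (- h1 + 1/2) / t1 * x) * qpoch_inf q (qpow L (- h2 + 1/2) / t2 * x)"

end

theory Submission
  imports Defs
begin

text \<open>
  Part (i) is the functional equation \<open>(z;q)\<^sub>\<infinity> = (1 - z) (qz;q)\<^sub>\<infinity>\<close>, which moves the quadratic factor
  from the coefficient of \<open>g(x/q)\<close> to that of \<open>g(qx)\<close>.  For the formal solutions, a nontrivial
  prefactor \<open>P\<close> moves it between the two shifts in the same way, and comparing coefficients of the
  powers of \<open>x\<close> leaves a three-term recurrence for \<open>a\<^sub>n\<close>.  Its coefficients factor so that dividing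
  out the power and
  \<open>(c;q)\<^sub>n\<close> reduces it, with \<open>a\<close> and \<open>b\<close> the two arguments of the inner sum, to
  \<open>(1 - q\<^sup>n) S\<^sub>n = (a + b) S\<^sub>n\<^sub>-\<^sub>1 - a b S\<^sub>n\<^sub>-\<^sub>2\<close> for the plain inner sums and
  \<open>(1 - q\<^sup>n) T\<^sub>n = (a + b) T\<^sub>n\<^sub>-\<^sub>1 + q\<^sup>1\<^sup>-\<^sup>n a b T\<^sub>n\<^sub>-\<^sub>2\<close> for the twisted ones.
\<close>

section \<open>The infinite product and powers of q\<close>

text \<open>Split the factor with i = 0 off each partial product and pass to the limit; convergence
  comes from the geometric series of the \<open>q ^ i * w\<close>.\<close>

lemma qpoch_inf_rec:
  assumes "norm q < 1"
  shows "qpoch_inf q z = (1 - z) * qpoch_inf q (q * z)"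
proof -
  have conv: "convergent_prod (\<lambda>i. 1 - q ^ i * w)" for w
  proof -
    have "summable (\<lambda>i. norm (q ^ i * w))"
      using assms by (simp add: norm_mult norm_power summable_mult2)
    then have "summable (\<lambda>i. norm ((1 - q ^ i * w) - 1))" by simp
    then show ?thesis
      by (intro abs_convergent_prod_imp_convergent_prod summable_imp_abs_convergent_prod)
  qed
  have "(\<lambda>n. \<Prod>i\<le>n. 1 - q ^ i * z) \<longlonglongrightarrow> qpoch_inf q z"
    using convergent_prod_LIMSEQ[OF conv] unfolding qpoch_inf_def .
  then have 1: "(\<lambda>n. \<Prod>i\<le>Suc n. 1 - q ^ i * z) \<longlonglongrightarrow> qpoch_inf q z"
    by (rule LIMSEQ_Suc)
  have "(\<lambda>n. (1 - z) * (\<Prod>i\<le>n. 1 - q ^ i * (q * z))) \<longlonglongrightarrow> (1 - z) * qpoch_inf q (q * z)"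
    using convergent_prod_LIMSEQ[OF conv] unfolding qpoch_inf_def by (rule tendsto_mult_left)
  moreover have "(\<Prod>i\<le>Suc n. 1 - q ^ i * z) = (1 - z) * (\<Prod>i\<le>n. 1 - q ^ i * (q * z))" for n
    by (subst prod.atMost_Suc_shift) (simp add: mult_ac)
  ultimately show ?thesis using 1 LIMSEQ_unique by auto
qed

lemma qpow_add: "qpow L (a + b) = qpow L a * qpow L b"
  by (simp add: qpow_def exp_add distrib_right)

lemma qpow_minus: "qpow L (- a) = inverse (qpow L a)"
  by (simp add: qpow_def exp_minus)

lemma qpow_diff: "qpow L (a - b) = qpow L a / qpow L b"
  by (simp add: qpow_def exp_diff left_diff_distrib)

lemma qpow_double: "qpow L (2 * a) = qpow L a ^ 2"
  by (simp add: qpow_def mult.assoc flip: exp_double)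

lemma qpow_nonzero: "qpow L a \<noteq> 0" by (simp add: qpow_def)

lemma qpow_of_nat: "qpow L (of_nat n) = qpow L 1 ^ n"
  by (simp add: qpow_def exp_of_nat_mult)

lemma qpow_half: "qpow L 1 = qpow L (1/2) ^ 2"
  by (simp flip: qpow_double)

section \<open>Power series under z -> qz and recurrences for the inner sums\<close>

text \<open>The substitution z -> qz in f(z), under which the q-exponential series satisfy
  first-order equations.\<close>

definition qdil :: "'a::comm_semiring_1 \<Rightarrow> 'a fps \<Rightarrow> 'a fps" where
  "qdil q f = Abs_fps (\<lambda>n. q ^ n * fps_nth f n)"

lemma qdil_mult: "qdil q (f * g) = qdil q f * qdil q g"
proof (rule fps_ext)
  fix n
  have "q ^ n * (fps_nth f i * fps_nth g (n - i)) =
      (q ^ i * fps_nth f i) * (q ^ (n - i) * fps_nth g (n - i))" if "i \<le> n" for i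
    using that power_add[of q i "n - i"] by (simp add: mult_ac)
  then show "fps_nth (qdil q (f * g)) n = fps_nth (qdil q f * qdil q g) n"
    by (auto simp: qdil_def fps_mult_nth sum_distrib_left intro!: sum.cong)
qed

text \<open>Turns an equation relating F(qz) and F(z) by a quadratic factor into a three-term
  recurrence with its initial equations.\<close>

lemma fps_nth_quadratic_mult:
  fixes f :: "'a::comm_ring_1 fps" and a b :: 'a
  defines "g \<equiv> (1 - fps_const a * fps_X) * (1 - fps_const b * fps_X) * f"
  shows "fps_nth g 0 = fps_nth f 0"
    and "fps_nth g (Suc 0) = fps_nth f (Suc 0) - (a + b) * fps_nth f 0"
    and "fps_nth g (Suc (Suc n)) =
      fps_nth f (Suc (Suc n)) - (a + b) * fps_nth f (Suc n) + a * b * fps_nth f n"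
proof -
  have "g = f - fps_const (a + b) * (fps_X * f) + fps_const (a * b) * (fps_X * (fps_X * f))"
    by (simp add: g_def algebra_simps flip: fps_const_mult fps_const_add)
  then show "fps_nth g 0 = fps_nth f 0"
    and "fps_nth g (Suc 0) = fps_nth f (Suc 0) - (a + b) * fps_nth f 0"
    and "fps_nth g (Suc (Suc n)) =
      fps_nth f (Suc (Suc n)) - (a + b) * fps_nth f (Suc n) + a * b * fps_nth f n"
    by (simp_all add: distrib_right mult.assoc)
qed

lemma qpoch_0: "qpoch q z 0 = 1"
  by (simp add: qpoch_def)

lemma qpoch_Suc: "qpoch q z (Suc n) = qpoch q z n * (1 - z * q ^ n)"
  by (simp add: qpoch_def)

lemma power_neq_1_of_norm_less_1:
  fixes q :: complex
  assumes "norm q < 1"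
  shows "q ^ Suc n \<noteq> 1"
proof
  assume "q ^ Suc n = 1"
  then have "norm q ^ Suc n = 1" by (metis norm_one norm_power)
  moreover have "norm q ^ Suc n < 1"
    using assms power_Suc_less_one[of "norm q" n] by (cases "q = 0") auto
  ultimately show False by simp
qed

lemma qpoch_q_nonzero:
  assumes "norm q < 1"
  shows "qpoch q q n \<noteq> 0"
  using power_neq_1_of_norm_less_1[OF assms] by (auto simp: qpoch_def)

text \<open>
  The sums are the coefficients of \<open>E\<^sub>a E\<^sub>b\<close>, where \<open>E\<^sub>a\<close> is the \<open>q\<close>-exponential series of \<open>az\<close>; the
  recurrence expresses \<open>E\<^sub>a(qz) = (1 - az) E\<^sub>a(z)\<close>.
\<close>

lemma inner_sum_recurrence:
  assumes q: "norm q < 1"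
  shows "(1 - q) * inner_sum q a b 1 = (a + b) * inner_sum q a b 0"
    and "(1 - q ^ (n + 2)) * inner_sum q a b (n + 2) =
      (a + b) * inner_sum q a b (n + 1) - a * b * inner_sum q a b n"
proof -
  define E where "E = (\<lambda>a. Abs_fps (\<lambda>k. a ^ k / qpoch q q k))"
  have qdil_E: "qdil q (E a) = (1 - fps_const a * fps_X) * E a" for a
  proof (rule fps_ext)
    fix n
    show "fps_nth (qdil q (E a)) n = fps_nth ((1 - fps_const a * fps_X) * E a) n"
      \<comment> \<open>At an index n >= 1 the second fact reads \<open>q ^ n \<noteq> 1\<close>,
        which permits division by the last factor of \<open>qpoch q q n\<close>.\<close>
      using qpoch_q_nonzero[OF q, of n] power_neq_1_of_norm_less_1[OF q, of "n - 1"]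
      by (cases n) (auto simp: qdil_def E_def qpoch_0 qpoch_Suc mult.assoc left_diff_distrib field_simps)
  qed
  have nth: "fps_nth (E a * E b) n = inner_sum q a b n" for n
    by (simp add: E_def inner_sum_def fps_mult_nth atLeast0AtMost)
  have eq: "qdil q (E a * E b) = (1 - fps_const a * fps_X) * (1 - fps_const b * fps_X) * (E a * E b)"
    by (simp add: qdil_mult qdil_E mult_ac)
  note coeff = fps_nth_quadratic_mult[of a b "E a * E b", folded eq, unfolded nth]
  have dil: "fps_nth (qdil q (E a * E b)) n = q ^ n * inner_sum q a b n" for n
    by (simp add: qdil_def nth)
  show "(1 - q) * inner_sum q a b 1 = (a + b) * inner_sum q a b 0"
    and "(1 - q ^ (n + 2)) * inner_sum q a b (n + 2) =
      (a + b) * inner_sum q a b (n + 1) - a * b * inner_sum q a b n"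
    using coeff(2) coeff(3)[of n] by (simp_all add: dil algebra_simps)
qed

lemma choose_two_add: "(m + n) choose 2 = (m choose 2) + (n choose 2) + m * n"
  by (induction n) (simp_all add: numeral_2_eq_2)

text \<open>By \<open>choose_two_add\<close> the weight \<open>q ^ (n choose 2)\<close> absorbs the
  twist q^(-k(n-k)) and splits over k and n-k, so the sum becomes a Cauchy product.\<close>

lemma inner_sum_twisted_eq:
  assumes "exp L = q" "q \<noteq> 0"
  shows "q ^ (n choose 2) * inner_sum_twisted q L a b n =
    (\<Sum>k\<le>n. (q ^ ((n - k) choose 2) * a ^ (n - k) / qpoch q q (n - k)) * (q ^ (k choose 2) * b ^ k / qpoch q q k))"
proof -
  have "q ^ (n choose 2) * qpow L (- (of_nat k * of_nat (n - k))) = q ^ ((n - k) choose 2) * q ^ (k choose 2)"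
    if "k \<le> n" for k
  proof -
    have "qpow L (- (of_nat k * of_nat (n - k))) = inverse (q ^ (k * (n - k)))"
      unfolding of_nat_mult[symmetric] qpow_minus qpow_of_nat using assms(1) by (simp add: qpow_def)
    then show ?thesis
      using choose_two_add[of k "n - k"] that assms(2) by (simp add: power_add)
  qed
  then show ?thesis
    unfolding inner_sum_twisted_def sum_distrib_left
    by (intro sum.cong) (simp_all add: field_simps)
qed

text \<open>
  Same idea with the other \<open>q\<close>-exponential, for which \<open>E\<^sub>a(z) = (1 + az) E\<^sub>a(qz)\<close>.
\<close>

lemma inner_sum_twisted_recurrence:
  fixes q L a b :: complex
  assumes q: "norm q < 1" and L: "exp L = q" and q0: "q \<noteq> 0"
  defines "T \<equiv> inner_sum_twisted q L a b"
  shows "(1 - q) * T 1 = (a + b) * T 0"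
    and "(1 - q ^ (n + 2)) * T (n + 2) = (a + b) * T (n + 1) + a * b / q ^ (n + 1) * T n"
proof -
  define E where "E = (\<lambda>a. Abs_fps (\<lambda>k. q ^ (k choose 2) * a ^ k / qpoch q q k))"
  have E: "E a = (1 - fps_const (- a) * fps_X) * qdil q (E a)" for a
  proof (rule fps_ext)
    fix n
    show "fps_nth (E a) n = fps_nth ((1 - fps_const (- a) * fps_X) * qdil q (E a)) n"
      using qpoch_q_nonzero[OF q, of n] power_neq_1_of_norm_less_1[OF q, of "n - 1"]
      by (cases n) (auto simp: qdil_def E_def qpoch_0 qpoch_Suc mult.assoc left_diff_distrib numeral_2_eq_2 power_add field_simps)
  qed
  \<comment> \<open>\<open>E b\<close> comes first: the summation index k of the Cauchy product
    belongs to the first factor, and in the sum it is the power of \<open>b\<close>.\<close>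
  have nth: "fps_nth (E b * E a) n = q ^ (n choose 2) * T n" for n
    unfolding T_def inner_sum_twisted_eq[OF L q0] fps_mult_nth atLeast0AtMost
    by (intro sum.cong) (simp_all add: E_def mult_ac)
  have eq: "E b * E a = (1 - fps_const (- a) * fps_X) * (1 - fps_const (- b) * fps_X) * qdil q (E b * E a)"
    by (subst E, subst (2) E) (simp add: qdil_mult mult_ac)
  note coeff = fps_nth_quadratic_mult[of "- a" "- b" "qdil q (E b * E a)", folded eq, unfolded nth]
  have dil: "fps_nth (qdil q (E b * E a)) n = q ^ n * q ^ (n choose 2) * T n" for n
    by (simp add: qdil_def nth)
  show "(1 - q) * T 1 = (a + b) * T 0"
    using coeff(2)[unfolded dil] by (simp add: numeral_2_eq_2 algebra_simps)
  \<comment> \<open>All weights become monomials in \<open>z\<close>, \<open>r\<close> and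
    \<open>q\<close>. The common factor \<open>z * z * q * r\<close> is q^((n+2) choose 2);
    cancelling it leaves 1/q^(n+1) on the last term.\<close>
  define r z where "r = q ^ (n choose 2)" and "z = q ^ n"
  have choose: "q ^ (Suc n choose 2) = z * r" "q ^ (Suc (Suc n) choose 2) = z * z * q * r"
    "q ^ Suc n = q * z" "q ^ Suc (Suc n) = q * q * z"
    by (simp_all add: r_def z_def numeral_2_eq_2 power_add)
  have "z * z * q * r * T (n + 2) =
      q * q * z * (z * z * q * r) * T (n + 2) + (a + b) * (q * z * (z * r) * T (n + 1)) + a * b * (z * r * T n)"
    using coeff(3)[of n, unfolded dil choose, folded r_def z_def] by (simp add: algebra_simps)
  moreover have "a * b * (z * r * T n) = z * z * q * r * (a * b / (q * z) * T n)"
    using q0 by (simp add: z_def)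
  ultimately have "z * z * q * r * ((1 - q * q * z) * T (n + 2)) =
      z * z * q * r * ((a + b) * T (n + 1) + a * b / (q * z) * T n)"
    by (simp only: ring_distribs) (simp add: mult_ac)
  then show "(1 - q ^ (n + 2)) * T (n + 2) = (a + b) * T (n + 1) + a * b / q ^ (n + 1) * T n"
    using q0 by (simp add: z_def r_def mult_ac)
qed

section \<open>Equations as operators on Laurent series in 1/x\<close>

lemma poly_fls_quadratic:
  "poly_fls [:a, b, c:] = fls_const a + fls_const b * fls_X_inv + fls_const c * fls_X_inv ^ 2"
  by (simp add: poly_fls_def map_poly_pCons power2_eq_square algebra_simps)

lemma poly_fls_1: "poly_fls 1 = 1"
  by (simp add: poly_fls_def)

lemma poly_fls_const: "poly_fls [:a:] = fls_const a"
  by (simp add: poly_fls_def map_poly_pCons)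

lemma poly_fls_lin_factors:
  "poly_fls (smult k ([:1, - a:] * [:1, - b:])) = fls_const k * (lin_factor a * lin_factor b)"
proof -
  have "smult k ([:1, - a:] * [:1, - b:]) = [:k, k * (- a + - b), k * (a * b):]"
    by (simp add: algebra_simps)
  then show ?thesis
    by (simp only: poly_fls_quadratic lin_factor_def fls_const_mult_const[symmetric]
        fls_plus_const[symmetric] fls_const_uminus) (simp add: algebra_simps power2_eq_square)
qed

lemma lin_factor_nonzero: "lin_factor a \<noteq> 0"
proof
  assume "lin_factor a = 0"
  then have "fls_nth (lin_factor a) 0 = 0" by simp
  then show False
    by (simp only: lin_factor_def fls_minus_nth fls_one_nth fls_mult_const_nth fls_X_inv_nth) simp
qed

text \<open>Factoring out x^2 leaves a power series in 1/x, which is \<open>fls_X\<close>: the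
  leading coefficient \<open>c\<close> acts without shift, \<open>b\<close> and \<open>a\<close>
  with shifts by one and two.\<close>

lemma poly_fls_times_fps:
  "poly_fls [:a, b, c:] * fps_to_fls f = fls_X_inv ^ 2 * fps_to_fls
     (fps_const c * f + fps_const b * (fps_X * f) + fps_const a * (fps_X * (fps_X * f)))"
proof -
  have "fls_X * inverse fls_X = (1 :: complex fls)"
    by (rule right_inverse) simp
  then have X: "fls_X * (fls_X_inv * g) = g" for g :: "complex fls"
    
    by (simp only: fls_inverse_X mult.assoc[symmetric] mult_1_left)
  show ?thesis
    by (simp add: poly_fls_quadratic fls_times_fps_to_fls power2_eq_square X distrib_left
        distrib_right mult_ac)
qed

text \<open>
  \<open>\<kappa>\<close> and \<open>\<kappa>'\<close> are the factors \<open>q\<^sup>\<mu>\<close> and \<open>q\<^sup>-\<^sup>\<mu>\<close> produced by shifting \<open>x\<^sup>\<mu>\<close>.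
\<close>

lemma three_term_operator_eq_0:
  fixes a :: "nat \<Rightarrow> complex" and q \<kappa> \<kappa>' :: complex
  defines "e \<equiv> \<lambda>u d m n. u * \<kappa> / q ^ n + d * \<kappa>' * q ^ n - m"
  assumes "e u2 d2 m2 0 * a 0 = 0"
    and "e u2 d2 m2 1 * a 1 + e u1 d1 m1 0 * a 0 = 0"
    and "\<And>n. e u2 d2 m2 (n + 2) * a (n + 2) + e u1 d1 m1 (n + 1) * a (n + 1) + e u0 d0 m0 n * a n = 0"
  shows "poly_fls [:u0, u1, u2:] * fls_const \<kappa> * fps_to_fls (Abs_fps (\<lambda>n. a n / q ^ n))
    + poly_fls [:d0, d1, d2:] * fls_const \<kappa>' * fps_to_fls (Abs_fps (\<lambda>n. a n * q ^ n))
    - poly_fls [:m0, m1, m2:] * fps_to_fls (Abs_fps a) = 0" (is "?lhs = 0")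
proof -
  define op :: "complex \<Rightarrow> complex \<Rightarrow> complex \<Rightarrow> complex fps \<Rightarrow> complex fps"
    where "op = (\<lambda>a b c f. fps_const c * f + fps_const b * (fps_X * f) + fps_const a * (fps_X * (fps_X * f)))"
  define S where "S = op u0 u1 u2 (fps_const \<kappa> * Abs_fps (\<lambda>n. a n / q ^ n))
     + op d0 d1 d2 (fps_const \<kappa>' * Abs_fps (\<lambda>n. a n * q ^ n)) - op m0 m1 m2 (Abs_fps a)"
  have "?lhs = fls_X_inv ^ 2 * fps_to_fls S"
    unfolding mult.assoc fps_const_to_fls[symmetric] fls_times_fps_to_fls[symmetric] poly_fls_times_fps
    by (simp only: S_def op_def fps_to_fls_plus fps_to_fls_minus ring_distribs mult.assoc)
  moreover have "S = 0"
  proof (rule fps_ext)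
    fix n :: nat
    \<comment> \<open>At indices 0 and 1 some of the shifted series do not contribute yet.\<close>
    consider "n = 0" | "n = 1" | k where "n = k + 2"
      by (metis One_nat_def add_2_eq_Suc' not0_implies_Suc)
    then show "fps_nth S n = fps_nth 0 n"
    proof cases
      case 1
      have "fps_nth S 0 = e u2 d2 m2 0 * a 0"
        by (simp add: S_def op_def e_def ring_distribs)
      with 1 assms(2) show ?thesis by simp
    next
      case 2
      have "fps_nth S 1 = e u2 d2 m2 1 * a 1 + e u1 d1 m1 0 * a 0"
        by (simp add: S_def op_def e_def ring_distribs)
      with 2 assms(3) show ?thesis by simp
    next
      case (3 k)
      have "fps_nth S (k + 2) = e u2 d2 m2 (k + 2) * a (k + 2) + e u1 d1 m1 (k + 1) * a (k + 1) + e u0 d0 m0 k * a k"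
        by (simp add: S_def op_def e_def ring_distribs mult.assoc)
      with 3 assms(4) show ?thesis by simp
    qed
  qed
  ultimately show ?thesis by simp
qed

text \<open>
  In the assumptions, \<open>z\<close> plays the role of \<open>q\<^sup>n\<close>.  The factors \<open>1 - c z\<close> are what makes the
  \<open>qpoch q c\<close> parts of three consecutive coefficients cancel.
\<close>

lemma inner_sum_twisted_operator_eq_0:
  fixes q L A B c w :: complex
  assumes q: "norm q < 1" and L: "exp L = q" and "q \<noteq> 0" and AB: "A \<noteq> 0" "B \<noteq> 0"
  defines "a \<equiv> \<lambda>n. w ^ n * qpoch q c n * inner_sum_twisted q L (1 / A) (1 / B) n"
  assumes e2: "\<And>z. z \<noteq> 0 \<Longrightarrow> u2 * \<kappa> / z + d2 * \<kappa>' * z - m2 = K * (A * B) * (z - 1)"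
    and e1: "\<And>z. z \<noteq> 0 \<Longrightarrow> u1 * \<kappa> / z + d1 * \<kappa>' * z - m1 = K * w * (A + B) * (1 - c * z)"
    and e0: "\<And>z. z \<noteq> 0 \<Longrightarrow>
      u0 * \<kappa> / z + d0 * \<kappa>' * z - m0 = K * w ^ 2 * (1 - c * z) * (1 - c * (q * z)) / (q * z)"
  shows "poly_fls [:u0, u1, u2:] * fls_const \<kappa> * fps_to_fls (Abs_fps (\<lambda>n. a n / q ^ n))
    + poly_fls [:d0, d1, d2:] * fls_const \<kappa>' * fps_to_fls (Abs_fps (\<lambda>n. a n * q ^ n))
    - poly_fls [:m0, m1, m2:] * fps_to_fls (Abs_fps a) = 0"
proof (rule three_term_operator_eq_0, goal_cases)
  define T where "T = inner_sum_twisted q L (1 / A) (1 / B)"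
  have a: "a = (\<lambda>n. w ^ n * qpoch q c n * T n)" by (simp add: a_def T_def)
  have qn: "q ^ n \<noteq> 0" for n using \<open>q \<noteq> 0\<close> by simp
  note rec = inner_sum_twisted_recurrence[OF q L \<open>q \<noteq> 0\<close>, where a = "1 / A" and b = "1 / B", folded T_def]
  note e = e2[OF qn] e1[OF qn] e0[OF qn]
  \<comment> \<open>\<open>A\<close> and \<open>B\<close> are the reciprocals of the arguments of
    the sum; multiplying its recurrence by \<open>A * B\<close> clears the denominators.\<close>
  have sum: "A * B * (1 / A + 1 / B) = A + B" and prod: "A * B * (1 / A * (1 / B)) = 1"
    using AB by (simp_all add: field_simps)
  {
    case 1
    \<comment> \<open>The factor \<open>z - 1\<close> vanishes at z = q^0: the indicial condition on
      the exponent.\<close>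
    show ?case by (simp only: e) simp
  next
    case 2
    have "A * B * (q - 1) * T 1 = - (A + B) * T 0"
      using arg_cong[OF rec(1), of "\<lambda>u. A * B * u"] unfolding sum[symmetric] by (simp add: algebra_simps)
    then have "A * B * (q - 1) * T 1 + (A + B) * T 0 = 0"
      by (simp add: algebra_simps)
    then have "K * w * (1 - c) * (A * B * (q - 1) * T 1 + (A + B) * T 0) = 0"
      by simp
    then show ?case
      by (simp only: e) (simp add: a qpoch_Suc qpoch_0 algebra_simps)
  next
    case (3 n)
    define z where "z = q ^ n"
    have z: "q ^ Suc n = q * z" "q ^ (n + 2) = q * q * z" "q ^ (n + 1) = q * z" by (simp_all add: z_def)
    have "A * B * ((1 - q * q * z) * T (n + 2)) =
        A * B * (1 / A + 1 / B) * T (n + 1) + A * B * (1 / A * (1 / B)) / (q * z) * T n"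
      using rec(2)[of n] unfolding z by (simp add: distrib_left)
    then have *: "A * B * (q * q * z - 1) * T (n + 2) + (A + B) * T (n + 1) + 1 / (q * z) * T n = 0"
      unfolding sum prod by (simp add: algebra_simps)
    \<comment> \<open>The multiplier is K w^(n+2) (c;q)_(n+2), common to all three terms.\<close>
    have "K * w ^ 2 * w ^ n * qpoch q c n * (1 - c * z) * (1 - c * (q * z)) *
        (A * B * (q * q * z - 1) * T (n + 2) + (A + B) * T (n + 1) + 1 / (q * z) * T n) = 0"
      by (simp only: *) simp
    then show ?case
      by (simp only: e, simp only: z z_def[symmetric])
        (simp add: a qpoch_Suc power2_eq_square divide_inverse algebra_simps flip: z_def)
  }
qed

text \<open>The recurrence of the plain sums enters divided by the power of \<open>q\<close> at the
  top index: \<open>1 / z\<close>, \<open>1 / (q * z)\<close> and \<open>1 / (q * q * z)\<close>,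
  taken at three consecutive indices in descending order, are all 1/q^(n+2).\<close>

lemma inner_sum_operator_eq_0:
  fixes q A B c w :: complex
  assumes q: "norm q < 1" and "q \<noteq> 0" and AB: "A \<noteq> 0" "B \<noteq> 0"
  defines "a \<equiv> \<lambda>n. w ^ n * qpoch q c n * inner_sum q (1 / A) (1 / B) n"
  assumes e2: "\<And>z. z \<noteq> 0 \<Longrightarrow> u2 * \<kappa> / z + d2 * \<kappa>' * z - m2 = K * (A * B) * (1 / z - 1)"
    and e1: "\<And>z. z \<noteq> 0 \<Longrightarrow>
      u1 * \<kappa> / z + d1 * \<kappa>' * z - m1 = - (K * w * (A + B) * (1 - c * z) / (q * z))"
    and e0: "\<And>z. z \<noteq> 0 \<Longrightarrow>
      u0 * \<kappa> / z + d0 * \<kappa>' * z - m0 = K * w ^ 2 * (1 - c * z) * (1 - c * (q * z)) / (q * q * z)"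
  shows "poly_fls [:u0, u1, u2:] * fls_const \<kappa> * fps_to_fls (Abs_fps (\<lambda>n. a n / q ^ n))
    + poly_fls [:d0, d1, d2:] * fls_const \<kappa>' * fps_to_fls (Abs_fps (\<lambda>n. a n * q ^ n))
    - poly_fls [:m0, m1, m2:] * fps_to_fls (Abs_fps a) = 0"
proof (rule three_term_operator_eq_0, goal_cases)
  define S where "S = inner_sum q (1 / A) (1 / B)"
  have a: "a = (\<lambda>n. w ^ n * qpoch q c n * S n)" by (simp add: a_def S_def)
  have qn: "q ^ n \<noteq> 0" for n using \<open>q \<noteq> 0\<close> by simp
  note rec = inner_sum_recurrence[OF q, where a = "1 / A" and b = "1 / B", folded S_def]
  have e2': "u2 * \<kappa> / z + d2 * \<kappa>' * z - m2 = K * (A * B) * ((1 - z) / z)" if "z \<noteq> 0" for z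
    using e2[OF that] that by (simp add: diff_divide_distrib)
  note e = e2'[OF qn] e1[OF qn] e0[OF qn]
  have sum: "A * B * (1 / A + 1 / B) = A + B" and prod: "A * B * (1 / A * (1 / B)) = 1"
    using AB by (simp_all add: field_simps)
  {
    case 1
    show ?case by (simp only: e) simp
  next
    case 2
    have "A * B * (1 - q) * S 1 = (A + B) * S 0"
      using arg_cong[OF rec(1), of "\<lambda>u. A * B * u"] unfolding sum[symmetric] by (simp add: mult.assoc)
    then have "K * w * (1 - c) / q * (A * B * (1 - q) * S 1 - (A + B) * S 0) = 0"
      by simp
    then show ?case
      by (simp only: e) (simp add: a qpoch_Suc qpoch_0 divide_inverse algebra_simps)
  next
    case (3 n)
    define z where "z = q ^ n"
    have z: "q ^ Suc n = q * z" "q ^ (n + 2) = q * q * z" "q ^ (n + 1) = q * z" by (simp_all add: z_def)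
    have "z \<noteq> 0" using qn z_def by simp
    have "A * B * ((1 - q * q * z) * S (n + 2)) =
        A * B * (1 / A + 1 / B) * S (n + 1) - A * B * (1 / A * (1 / B)) * S n"
      using rec(2)[of n] unfolding z by (simp add: right_diff_distrib)
    then have *: "A * B * (1 - q * q * z) * S (n + 2) - (A + B) * S (n + 1) + S n = 0"
      unfolding sum prod by (simp add: algebra_simps)
    have "K * w ^ 2 * w ^ n * qpoch q c n * (1 - c * z) * (1 - c * (q * z)) / (q * q * z) *
        (A * B * (1 - q * q * z) * S (n + 2) - (A + B) * S (n + 1) + S n) = 0"
      by (simp only: *) simp
    then show ?case
      by (simp only: e, simp only: z z_def[symmetric])
        (simp add: a qpoch_Suc power2_eq_square divide_inverse algebra_simps flip: z_def)
  }
qed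

lemma poly_fls_lin_factors_expanded:
  "fls_const k * (lin_factor a * lin_factor b) = poly_fls [:k, - (k * (a + b)), k * a * b:]"
  unfolding poly_fls_lin_factors[symmetric] by (simp add: algebra_simps)

text \<open>Used with \<open>m\<close> the quadratic factor of a coefficient of the equation and
  \<open>m'\<close> the rational factor produced by shifting P.\<close>

lemma mult_cancel_middle:
  fixes k :: "'a::comm_monoid_mult"
  assumes "m * m' = 1"
  shows "k * m * (m' * c * f) = k * c * f"
proof -
  have "k * m * (m' * c * f) = k * (m * m') * c * f" by (simp only: mult_ac)
  then show ?thesis by (simp add: assms)
qed

section \<open>The three equations in common parameters\<close>

locale q_equation_parameters =
  fixes q L \<alpha> lam h1 h2 t1 t2 :: complex
  assumes norm_q: "norm q < 1" and L: "exp L = q" and t1: "t1 \<noteq> 0" and t2: "t2 \<noteq> 0"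
begin

text \<open>In these parameters all coefficients are rational expressions with
  \<open>q = s ^ 2\<close>, so the conditions on them reduce to field arithmetic. \<open>h1\<close>,
  \<open>h2\<close> also stand for \<open>l1\<close>, \<open>l2\<close>.\<close>

definition "s = qpow L (1/2)"
definition "Q = qpow L lam"
definition "p = qpow L \<alpha>"
definition "A = qpow L (- h1) / t1"
definition "B = qpow L (- h2) / t2"

lemma nonzero [simp]: "q \<noteq> 0" "s \<noteq> 0" "Q \<noteq> 0" "p \<noteq> 0" "A \<noteq> 0" "B \<noteq> 0"
  using L t1 t2 by (auto simp: s_def Q_def p_def A_def B_def qpow_nonzero)

lemma q_eq: "q = s ^ 2"
  unfolding s_def qpow_half[symmetric] using L by (simp add: qpow_def)

lemma qpow_1: "qpow L 1 = q"
  using L by (simp add: qpow_def)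

lemma qpow_neg_double: "qpow L (- 2 * x) = inverse (qpow L x ^ 2)"
  by (simp flip: qpow_double qpow_minus)

lemmas qpow_simps = qpow_neg_double qpow_1 qpow_add qpow_diff qpow_minus qpow_double
  s_def[symmetric] Q_def[symmetric] p_def[symmetric]

lemma root_eq:
  "qpow L (- h1 + 1/2) / t1 = s * A" "qpow L (- h2 + 1/2) / t2 = s * B"
  "qpow L (- h1 - 1/2) / t1 = A / s" "qpow L (- h2 - 1/2) / t2 = B / s"
  "qpow L h1 * t1 = 1 / A" "qpow L h2 * t2 = 1 / B"
  unfolding A_def B_def qpow_simps by (simp_all add: field_simps qpow_nonzero)

text \<open>Matches the factors that P(x/q)/P(x) produces with the linear factors of the coefficient
  of g(x/q) in (A).\<close>

lemma root_div_q: "s * A / q = A / s" "s * B / q = B / s"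
  by (simp_all add: q_eq power2_eq_square)

lemma eqn_A_eq:
  "eqn_A q L \<alpha> lam h1 h2 t1 t2 =
    \<lparr>up_coeff = 1, down_coeff = smult (Q ^ 2 * q) ([:1, - (A / s):] * [:1, - (B / s):]),
     mid_coeff = [:Q * (q + 1), - (Q * s * (A + B)), p * Q ^ 2 * A * B:]\<rparr>"
  unfolding eqn_A_def root_eq A_def B_def qpow_simps by (simp add: field_simps)

text \<open>The relation between \<open>\<alpha>'\<close> and \<open>\<alpha>\<close> serves to make
  the middle coefficients of (A) and (B) equal.\<close>

lemma eqn_B_eq:
  assumes "\<alpha>' + \<alpha> = 1 - 2 * lam"
  shows "eqn_B q L \<alpha>' lam h1 h2 t1 t2 =
    \<lparr>up_coeff = [:1, - (s * A):] * [:1, - (s * B):], down_coeff = [:Q ^ 2 * q:],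
     mid_coeff = [:Q * (q + 1), - (Q * s * (A + B)), p * Q ^ 2 * A * B:]\<rparr>"
proof -
  have "- \<alpha>' - h1 - h2 + 1 = \<alpha> + 2 * lam - h1 - h2"
    using assms by (simp add: algebra_simps)
  then show ?thesis
    unfolding eqn_B_def root_eq A_def B_def by (simp only: qpow_simps) (simp add: field_simps)
qed

lemma eqn_20_eq:
  "eqn_20 q L \<alpha> lam h1 h2 t1 t2 =
    \<lparr>up_coeff = smult (1 / (Q ^ 2 * q)) ([:1, - (s * A):] * [:1, - (s * B):]), down_coeff = 1,
     mid_coeff = [:(1 + 1 / q) / Q, - ((A + B) / (Q * s)), A * B / (p * Q ^ 2):]\<rparr>"
  unfolding eqn_20_def root_eq A_def B_def qpow_simps by (simp add: field_simps)

section \<open>The four formal solutions\<close>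

lemma formal_solution_g1:
  "formal_solution q L (eqn_A q L \<alpha> lam h1 h2 t1 t2) (g1 q L \<alpha> lam h1 h2 t1 t2)"
proof -
  have g1: "g1 q L \<alpha> lam h1 h2 t1 t2 = \<lparr>factors = [], expo = - \<alpha>,
      coeffs = (\<lambda>n. (s / (Q * p)) ^ n * qpoch q (Q * p) n * inner_sum_twisted q L (1 / A) (1 / B) n)\<rparr>"
    unfolding g1_def root_eq unfolding qpow_simps by (simp add: field_simps)
  have one: "poly_fls 1 = poly_fls [:1, 0, 0:]" by (simp add: poly_fls_1 poly_fls_const)
  show ?thesis
    unfolding formal_solution_def eqn_A_eq g1 shift_up_def shift_down_def shift_none_def qde.simps
      qformal.simps poly_fls_lin_factors poly_fls_lin_factors_expanded one list.map prod_list.Nil mult_1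
    unfolding mult.assoc[symmetric]
  \<comment> \<open>\<open>K\<close> is read off the x^2 terms: shifting x^(-\<alpha>) down gives
    the factor \<open>p\<close>, and they combine to p Q^2 A B (z - 1).\<close>
  by (rule inner_sum_twisted_operator_eq_0[where K = "p * Q ^ 2"])
      (use norm_q L in \<open>simp_all add: qpow_simps q_eq field_simps power2_eq_square\<close>)
qed

lemma formal_solution_g4:
  "formal_solution q L (eqn_20 q L \<alpha> lam h1 h2 t1 t2) (g4 q L \<alpha> lam h1 h2 t1 t2)"
proof -
  have g4: "g4 q L \<alpha> lam h1 h2 t1 t2 = \<lparr>factors = [], expo = - \<alpha>,
      coeffs = (\<lambda>n. s ^ n * qpoch q (Q * p) n * inner_sum q (1 / A) (1 / B) n)\<rparr>"
    unfolding g4_def root_eq unfolding qpow_simps by simp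
  have one: "poly_fls 1 = poly_fls [:1, 0, 0:]" by (simp add: poly_fls_1 poly_fls_const)
  show ?thesis
    unfolding formal_solution_def eqn_20_eq g4 shift_up_def shift_down_def shift_none_def qde.simps
      qformal.simps poly_fls_lin_factors poly_fls_lin_factors_expanded one list.map prod_list.Nil mult_1
    unfolding mult.assoc[symmetric]
  by (rule inner_sum_operator_eq_0[where K = "1 / (p * Q ^ 2)"])
      (use norm_q L in \<open>simp_all add: qpow_simps q_eq field_simps power2_eq_square\<close>)
qed

lemma qpow_gauge_expo: "qpow L (2 * lam + \<alpha> - 1) = Q ^ 2 * p / q" "qpow L (- (2 * lam + \<alpha> - 1)) = q / (Q ^ 2 * p)"
  unfolding qpow_simps by (simp_all add: field_simps)

text \<open>The prefactor has exponents -1, so shifting down cancels the quadratic coefficient of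
  (A) while shifting up creates one. The quadratic now sits on the up-shift, as for g4, whence the
  plain sums.\<close>

lemma formal_solution_g2:
  "formal_solution q L (eqn_A q L \<alpha> lam h1 h2 t1 t2) (g2 q L \<alpha> lam h1 h2 t1 t2)"
proof -
  let ?c = "\<lambda>n. s ^ n * qpoch q (q / (Q * p)) n * inner_sum q (1 / A) (1 / B) n"
  have g2: "g2 q L \<alpha> lam h1 h2 t1 t2 = \<lparr>factors = [(s * A, - 1), (s * B, - 1)],
      expo = 2 * lam + \<alpha> - 1, coeffs = ?c\<rparr>"
    unfolding g2_def root_eq unfolding qpow_simps by (simp add: field_simps)
  have up: "shift_up q L (g2 q L \<alpha> lam h1 h2 t1 t2) = poly_fls [:1, - (s * A + s * B), s * A * (s * B):]
      * fls_const (Q ^ 2 * p / q) * fps_to_fls (Abs_fps (\<lambda>n. ?c n / q ^ n))"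
    using poly_fls_lin_factors_expanded[of 1 "s * A" "s * B"]
    unfolding g2 shift_up_def qformal.simps qpow_gauge_expo by simp
  have down: "poly_fls (down_coeff (eqn_A q L \<alpha> lam h1 h2 t1 t2)) * shift_down q L (g2 q L \<alpha> lam h1 h2 t1 t2)
      = poly_fls [:Q ^ 2 * q, 0, 0:] * fls_const (q / (Q ^ 2 * p)) * fps_to_fls (Abs_fps (\<lambda>n. ?c n * q ^ n))"
    unfolding g2 shift_down_def qformal.simps qpow_gauge_expo eqn_A_eq qde.simps poly_fls_lin_factors
      pCons_0_0 poly_fls_const
    by (rule mult_cancel_middle) (simp add: root_div_q power_int_minus lin_factor_nonzero field_simps)
  show ?thesis
    unfolding formal_solution_def up down
    unfolding eqn_A_eq g2 shift_none_def qde.simps qformal.simps poly_fls_1 mult_1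
  by (rule inner_sum_operator_eq_0[where K = "p * Q ^ 2"])
      (use norm_q L in \<open>simp_all add: q_eq field_simps power2_eq_square\<close>)
qed

text \<open>Mirror image of g2: exponents +1 move the quadratic from the up-shift to the down-shift,
  as for g1, whence the twisted sums.\<close>

lemma formal_solution_g3:
  "formal_solution q L (eqn_20 q L \<alpha> lam h1 h2 t1 t2) (g3 q L \<alpha> lam h1 h2 t1 t2)"
proof -
  let ?c = "\<lambda>n. (Q * p / s) ^ n * qpoch q (q / (Q * p)) n * inner_sum_twisted q L (1 / A) (1 / B) n"
  have g3: "g3 q L \<alpha> lam h1 h2 t1 t2 = \<lparr>factors = [(s * A, 1), (s * B, 1)],
      expo = 2 * lam + \<alpha> - 1, coeffs = ?c\<rparr>"
    unfolding g3_def root_eq unfolding qpow_simps by (simp add: field_simps)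
  have down: "shift_down q L (g3 q L \<alpha> lam h1 h2 t1 t2) = poly_fls [:1, - (A / s + B / s), A / s * (B / s):]
      * fls_const (q / (Q ^ 2 * p)) * fps_to_fls (Abs_fps (\<lambda>n. ?c n * q ^ n))"
    using poly_fls_lin_factors_expanded[of 1 "A / s" "B / s"]
    unfolding g3 shift_down_def qformal.simps qpow_gauge_expo by (simp add: root_div_q)
  have up: "poly_fls (up_coeff (eqn_20 q L \<alpha> lam h1 h2 t1 t2)) * shift_up q L (g3 q L \<alpha> lam h1 h2 t1 t2)
      = poly_fls [:1 / (Q ^ 2 * q), 0, 0:] * fls_const (Q ^ 2 * p / q) * fps_to_fls (Abs_fps (\<lambda>n. ?c n / q ^ n))"
    unfolding g3 shift_up_def qformal.simps qpow_gauge_expo eqn_20_eq qde.simps poly_fls_lin_factors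
      pCons_0_0 poly_fls_const
    by (rule mult_cancel_middle) (simp add: power_int_minus lin_factor_nonzero field_simps)
  show ?thesis
    unfolding formal_solution_def up down
    unfolding eqn_20_eq g3 shift_none_def qde.simps qformal.simps poly_fls_1 mult_1
  by (rule inner_sum_twisted_operator_eq_0[where K = "1 / (p * Q ^ 2)"])
      (use norm_q L in \<open>simp_all add: q_eq field_simps power2_eq_square\<close>)
qed

section \<open>Transformation between (A) and (B)\<close>

lemma prefactor_q_mult:
  "prefactor q L h1 h2 t1 t2 x =
    (1 - s * A * x) * (1 - s * B * x) * prefactor q L h1 h2 t1 t2 (q * x)"
  using qpoch_inf_rec[OF norm_q, of "s * A * x"] qpoch_inf_rec[OF norm_q, of "s * B * x"]
  unfolding prefactor_def root_eq by (simp add: mult_ac)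

lemma prefactor_q_div:
  "prefactor q L h1 h2 t1 t2 (x / q) =
    (1 - A / s * x) * (1 - B / s * x) * prefactor q L h1 h2 t1 t2 x"
  using prefactor_q_mult[of "x / q"] by (simp add: q_eq power2_eq_square)

lemma holds_at_eqn_A_iff:
  "holds_at q (eqn_A q L \<alpha> lam h1 h2 t1 t2) y x \<longleftrightarrow>
    y (q * x) + Q ^ 2 * q * ((1 - A / s * x) * (1 - B / s * x)) * y (x / q)
      - poly [:Q * (q + 1), - (Q * s * (A + B)), p * Q ^ 2 * A * B:] x * y x = 0"
proof -
  have "poly [:1, - a:] x = 1 - a * x" for a :: complex by simp
  then show ?thesis
    unfolding holds_at_def eqn_A_eq qde.simps by (simp only: poly_smult poly_mult poly_1 mult_1_left)
qed

lemma holds_at_eqn_B_iff: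
  assumes "\<alpha>' + \<alpha> = 1 - 2 * lam"
  shows "holds_at q (eqn_B q L \<alpha>' lam h1 h2 t1 t2) u x \<longleftrightarrow>
    (1 - s * A * x) * (1 - s * B * x) * u (q * x) + Q ^ 2 * q * u (x / q)
      - poly [:Q * (q + 1), - (Q * s * (A + B)), p * Q ^ 2 * A * B:] x * u x = 0"
proof -
  have "poly [:1, - a:] x = 1 - a * x" "poly [:a:] x = a" for a :: complex by simp_all
  then show ?thesis
    unfolding holds_at_def eqn_B_eq[OF assms] qde.simps by (simp only: poly_mult)
qed

lemma holds_at_eqn_B_prefactor_mult:
  assumes "\<alpha>' + \<alpha> = 1 - 2 * lam" and "holds_at q (eqn_A q L \<alpha> lam h1 h2 t1 t2) y x"
  shows "holds_at q (eqn_B q L \<alpha>' lam h1 h2 t1 t2) (\<lambda>z. prefactor q L h1 h2 t1 t2 z * y z) x"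
proof -
  define F M where "F = prefactor q L h1 h2 t1 t2"
    and "M = poly [:Q * (q + 1), - (Q * s * (A + B)), p * Q ^ 2 * A * B:] x"
  \<comment> \<open>Equation (A) is multiplied by \<open>F x\<close>, which the functional equation
    converts into \<open>F (q * x)\<close> and \<open>F (x / q)\<close>. Nothing is divided, so
    zeros of \<open>F\<close> do no harm.\<close>
  have "F x * (y (q * x) + Q ^ 2 * q * ((1 - A / s * x) * (1 - B / s * x)) * y (x / q) - M * y x) = 0"
    using assms(2) unfolding holds_at_eqn_A_iff M_def by simp
  moreover have "F x * (y (q * x) + Q ^ 2 * q * ((1 - A / s * x) * (1 - B / s * x)) * y (x / q) - M * y x)
      = F x * y (q * x) + Q ^ 2 * q * ((1 - A / s * x) * (1 - B / s * x) * F x * y (x / q)) - M * (F x * y x)"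
    by (simp only: ring_distribs mult_ac)
  moreover have "(1 - s * A * x) * (1 - s * B * x) * (F (q * x) * y (q * x)) = F x * y (q * x)"
    unfolding F_def prefactor_q_mult[of x] by (simp only: mult.assoc)
  moreover have "F (x / q) = (1 - A / s * x) * (1 - B / s * x) * F x"
    unfolding F_def by (rule prefactor_q_div)
  ultimately show ?thesis
    unfolding holds_at_eqn_B_iff[OF assms(1)] F_def[symmetric] M_def[symmetric] by (simp only:)
qed

lemma holds_at_eqn_A_prefactor_div:
  assumes "\<alpha>' + \<alpha> = 1 - 2 * lam" and "holds_at q (eqn_B q L \<alpha>' lam h1 h2 t1 t2) u x"
    and "prefactor q L h1 h2 t1 t2 x \<noteq> 0" "prefactor q L h1 h2 t1 t2 (x / q) \<noteq> 0"
  shows "holds_at q (eqn_A q L \<alpha> lam h1 h2 t1 t2) (\<lambda>z. u z / prefactor q L h1 h2 t1 t2 z) x"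
proof -
  define F M where "F = prefactor q L h1 h2 t1 t2"
    and "M = poly [:Q * (q + 1), - (Q * s * (A + B)), p * Q ^ 2 * A * B:] x"
  define c where "c = (1 - s * A * x) * (1 - s * B * x)"
  note nz = assms(3,4)[folded F_def]
  have F: "F x = c * F (q * x)"
    using prefactor_q_mult[of x] by (simp only: F_def c_def)
  \<comment> \<open>\<open>c\<close> divides \<open>F x\<close>, which is nonzero.\<close>
  then have "c \<noteq> 0" using nz by auto
  then have up: "u (q * x) / F (q * x) = c * u (q * x) / F x"
    by (simp add: F)
  have down: "(1 - A / s * x) * (1 - B / s * x) * (u (x / q) / F (x / q)) = u (x / q) / F x"
    using nz prefactor_q_div[of x, folded F_def] by simp
  have "(c * u (q * x) + Q ^ 2 * q * u (x / q) - M * u x) / F x = 0"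
    using assms(2) unfolding holds_at_eqn_B_iff[OF assms(1)] M_def c_def by simp
  then have "u (q * x) / F (q * x) + Q ^ 2 * q * ((1 - A / s * x) * (1 - B / s * x) * (u (x / q) / F (x / q)))
      - M * (u x / F x) = 0"
    unfolding up down by (simp add: add_divide_distrib diff_divide_distrib)
  then show ?thesis
    unfolding holds_at_eqn_A_iff F_def[symmetric] M_def[symmetric] by (simp only: mult.assoc)
qed

end

theorem proposition6p4:
  fixes q L \<alpha>\<^sub>1 lam t1 t2 :: complex
  assumes "0 < norm q" and "norm q < 1" and "exp L = q"
    and "t1 \<noteq> 0" and "t2 \<noteq> 0"
  shows
    "(\<forall>h1 h2 l1 l2 \<alpha>' :: complex. l1 = h1 \<longrightarrow> l2 = h2 \<longrightarrow> \<alpha>' + \<alpha>\<^sub>1 = 1 - 2 * lam \<longrightarrow>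
        (\<forall>D. q_stable q D \<longrightarrow>
          (\<forall>y. (\<forall>x\<in>D. holds_at q (eqn_A q L \<alpha>\<^sub>1 lam h1 h2 t1 t2) y x) \<longrightarrow>
            (\<forall>x\<in>D. holds_at q (eqn_B q L \<alpha>' lam l1 l2 t1 t2)
                      (\<lambda>z. prefactor q L h1 h2 t1 t2 z * y z) x)) \<and>
          (\<forall>u. (\<forall>x\<in>D. holds_at q (eqn_B q L \<alpha>' lam l1 l2 t1 t2) u x) \<longrightarrow>
            (\<forall>x\<in>D. prefactor q L l1 l2 t1 t2 x \<noteq> 0 \<longrightarrow>
                    prefactor q L l1 l2 t1 t2 (q * x) \<noteq> 0 \<longrightarrow>
                    prefactor q L l1 l2 t1 t2 (x / q) \<noteq> 0 \<longrightarrow>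
                    holds_at q (eqn_A q L \<alpha>\<^sub>1 lam h1 h2 t1 t2)
                      (\<lambda>z. u z / prefactor q L l1 l2 t1 t2 z) x)))) \<and>
     (\<forall>h1 h2 :: complex.
        formal_solution q L (eqn_A q L \<alpha>\<^sub>1 lam h1 h2 t1 t2) (g1 q L \<alpha>\<^sub>1 lam h1 h2 t1 t2) \<and>
        formal_solution q L (eqn_A q L \<alpha>\<^sub>1 lam h1 h2 t1 t2) (g2 q L \<alpha>\<^sub>1 lam h1 h2 t1 t2)) \<and>
     (\<forall>l1 l2 :: complex.
        formal_solution q L (eqn_20 q L \<alpha>\<^sub>1 lam l1 l2 t1 t2) (g3 q L \<alpha>\<^sub>1 lam l1 l2 t1 t2) \<and>
        formal_solution q L (eqn_20 q L \<alpha>\<^sub>1 lam l1 l2 t1 t2) (g4 q L \<alpha>\<^sub>1 lam l1 l2 t1 t2))"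
proof -
  \<comment> \<open>The locale predicate constrains only these four parameters, so one instance
    serves all exponents, with \<open>l1\<close>, \<open>l2\<close> in place of \<open>h1\<close>,
    \<open>h2\<close> as well.\<close>
  have par: "q_equation_parameters q L t1 t2"
    using assms by (simp add: q_equation_parameters_def)
  show ?thesis
    using par
    by (simp add: q_equation_parameters.holds_at_eqn_B_prefactor_mult
        q_equation_parameters.holds_at_eqn_A_prefactor_div
        q_equation_parameters.formal_solution_g1 q_equation_parameters.formal_solution_g2
        q_equation_parameters.formal_solution_g3 q_equation_parameters.formal_solution_g4)
qed

end
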